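(* For any $\epsilon>0$ and $n\ge3$, the mechanism which outputs the parity function of the sample set is $(\epsilon,0)$-LMI (satisfies $(\epsilon,0)$-Local-Max-Information) but not $\left(1,\frac15\right)$-MI (it does not have $\frac15$-approximate max-information of $1$).
   Context: $\mathcal X$ is a countable set, samples are $s=(s_1,\dots,s_n)\in\mathcal X^n$ drawn from a distribution $D_{\mathcal X^n}$, and a mechanism $M$ is a possibly randomized function of a sample and a query $q$ with values in a countable response set $\mathcal R$. For fixed $q$ write $D(r\mid s)=\Pr[M(s,q)=r]$. Parity mechanism: relative to a function $f:\mathcal X\to\{0,1\}$, it outputs (for every query) the parity of the vector $(f(s_1),\dots,f(s_n))$, i.e. $M(s,q)=|\{i:f(s_i)=1\}|\bmod2$, so $\mathcal R=\{0,1\}$. Induced distributions: $D(s)=D_{\mathcal X^n}(s)$, $D(r)=\sum_sD(s)D(r\mid s)$, $D(x\mid s)=\frac1n|\{i:s_i=x\}|$, $D(x)=\sum_sD(s)D(x\mid s)$. On $\mathcal X^n\times\mathcal R$: joint $D_{(\mathcal X^n,\mathcal R)}(s,r)=D(s)D(r\mid s)$ and product $D_{\mathcal X^n\otimes\mathcal R}(s,r)=D(s)D(r)$. On $\mathcal X\times\mathcal R$: joint $D_{(\mathcal X,\mathcal R)}(x,r)=\sum_sD(s)D(x\mid s)D(r\mid s)$ and product $D_{\mathcal X\otimes\mathcal R}(x,r)=D(x)D(r)$. Two distributions $D_1,D_2$ on a set are $(\epsilon,\delta)$-indistinguishable if for every subset $\mathbf b$, $D_1(\mathbf b)\le e^\epsilon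 D_2(\mathbf b)+\delta$ and $D_2(\mathbf b)\le e^\epsilon D_1(\mathbf b)+\delta$. With respect to $D_{\mathcal X^n}$ and $q$, $M$ has $\delta$-approximate max-information of $\epsilon$ ($(\epsilon,\delta)$-MI) if $D_{(\mathcal X^n,\mathcal R)}$ and $D_{\mathcal X^n\otimes\mathcal R}$ are $(\epsilon,\delta)$-indistinguishable; $M$ is $(\epsilon,\delta)$-LMI if $D_{(\mathcal X,\mathcal R)}$ and $D_{\mathcal X\otimes\mathcal R}$ are $(\epsilon,\delta)$-indistinguishable. The theorem is a separation result (MI is strictly stronger than LMI) and its statement does not name the underlying distribution. For orientation only: the source establishes it, taking $\epsilon\le0.7$ without loss of generality, for $D_{\mathcal X^n}$ the product of a distribution $D_{\mathcal X}$ with $D_{\mathcal X}(\{x:f(x)=1\})=\frac12+\alpha$, $0\le\alpha\le\frac\epsilon7$. *)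

theory Defs
  imports "HOL-Probability.Probability"
begin

text \<open>
  A sample in \<open>X\<^sup>n\<close> is a list of length \<open>n\<close>, and a distribution on \<open>X\<^sup>n\<close> is a pmf on lists
  supported on lists of length \<open>n\<close>.  A mechanism maps a sample and a query to a distribution on
  responses, so \<open>D(r | s)\<close> is \<open>pmf (M s q) r\<close>.
\<close>

type_synonym ('x, 'q, 'r) mechanism = "'x list \<Rightarrow> 'q \<Rightarrow> 'r pmf"

definition indistinguishable :: "real \<Rightarrow> real \<Rightarrow> 'a pmf \<Rightarrow> 'a pmf \<Rightarrow> bool" where
  "indistinguishable \<epsilon> \<delta> D1 D2 \<longleftrightarrow>
     (\<forall>b. measure_pmf.prob D1 b \<le> exp \<epsilon> * measure_pmf.prob D2 b + \<delta> \<and>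
          measure_pmf.prob D2 b \<le> exp \<epsilon> * measure_pmf.prob D1 b + \<delta>)"

definition response_dist ::
  "'x list pmf \<Rightarrow> ('x, 'q, 'r) mechanism \<Rightarrow> 'q \<Rightarrow> 'r pmf" where
  "response_dist D M q = bind_pmf D (\<lambda>s. M s q)"

text \<open>The distribution \<open>D(x | s)\<close> of a uniformly chosen entry; meaningful for nonempty \<open>s\<close>.\<close>

definition elem_given_sample :: "'x list \<Rightarrow> 'x pmf" where
  "elem_given_sample s = map_pmf (\<lambda>i. s ! i) (pmf_of_set {..<length s})"

definition elem_dist :: "'x list pmf \<Rightarrow> 'x pmf" where
  "elem_dist D = bind_pmf D elem_given_sample"

definition joint_sample ::
  "'x list pmf \<Rightarrow> ('x, 'q, 'r) mechanism \<Rightarrow> 'q \<Rightarrow> ('x list \<times> 'r) pmf" where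
  "joint_sample D M q = bind_pmf D (\<lambda>s. map_pmf (Pair s) (M s q))"

definition prod_sample ::
  "'x list pmf \<Rightarrow> ('x, 'q, 'r) mechanism \<Rightarrow> 'q \<Rightarrow> ('x list \<times> 'r) pmf" where
  "prod_sample D M q = pair_pmf D (response_dist D M q)"

text \<open>Given the sample, the chosen entry and the response are independent.\<close>

definition joint_elem ::
  "'x list pmf \<Rightarrow> ('x, 'q, 'r) mechanism \<Rightarrow> 'q \<Rightarrow> ('x \<times> 'r) pmf" where
  "joint_elem D M q = bind_pmf D (\<lambda>s. pair_pmf (elem_given_sample s) (M s q))"

definition prod_elem ::
  "'x list pmf \<Rightarrow> ('x, 'q, 'r) mechanism \<Rightarrow> 'q \<Rightarrow> ('x \<times> 'r) pmf" where
  "prod_elem D M q = pair_pmf (elem_dist D) (response_dist D M q)"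

text \<open>
  The parameters are in the order \<open>(\<epsilon>, \<delta>)\<close>: \<open>MI \<epsilon> \<delta>\<close> is \<open>\<delta>\<close>-approximate max-information of \<open>\<epsilon>\<close>.
\<close>

definition MI ::
  "real \<Rightarrow> real \<Rightarrow> 'x list pmf \<Rightarrow> ('x, 'q, 'r) mechanism \<Rightarrow> 'q \<Rightarrow> bool" where
  "MI \<epsilon> \<delta> D M q \<longleftrightarrow> indistinguishable \<epsilon> \<delta> (joint_sample D M q) (prod_sample D M q)"

definition LMI ::
  "real \<Rightarrow> real \<Rightarrow> 'x list pmf \<Rightarrow> ('x, 'q, 'r) mechanism \<Rightarrow> 'q \<Rightarrow> bool" where
  "LMI \<epsilon> \<delta> D M q \<longleftrightarrow> indistinguishable \<epsilon> \<delta> (joint_elem D M q) (prod_elem D M q)"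

definition parity_mechanism :: "('x \<Rightarrow> nat) \<Rightarrow> ('x, 'q, nat) mechanism" where
  "parity_mechanism f s q = return_pmf (card {i. i < length s \<and> f (s ! i) = 1} mod 2)"

text \<open>The mass functions of the distributions above.\<close>

lemma pmf_bind_infsum:
  "pmf (bind_pmf D g) y = (\<Sum>\<^sub>\<infinity>s. pmf D s * pmf (g s) y)"
proof -
  have "Infinite_Set_Sum.abs_summable_on (\<lambda>s. pmf D s * pmf (g s) y) UNIV"
    by (rule abs_summable_on_comparison_test'[OF pmf_abs_summable[of D]])
       (auto intro: mult_left_le simp: pmf_le_1)
  then show ?thesis
    by (simp add: pmf_bind pmf_expectation_eq_infsetsum infsetsum_infsum)
qed

lemma pmf_response_dist:
  "pmf (response_dist D M q) r = (\<Sum>\<^sub>\<infinity>s. pmf D s * pmf (M s q) r)"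
  by (simp add: response_dist_def pmf_bind_infsum)

lemma pmf_elem_given_sample:
  assumes "s \<noteq> []"
  shows "pmf (elem_given_sample s) x = real (card {i. i < length s \<and> s ! i = x}) / real (length s)"
proof -
  have "{..<length s} \<inter> (\<lambda>i. s ! i) -` {x} = {i. i < length s \<and> s ! i = x}"
    by auto
  with assms show ?thesis
    by (simp add: elem_given_sample_def pmf_map measure_pmf_of_set lessThan_empty_iff)
qed

lemma pmf_elem_dist:
  "pmf (elem_dist D) x = (\<Sum>\<^sub>\<infinity>s. pmf D s * pmf (elem_given_sample s) x)"
  by (simp add: elem_dist_def pmf_bind_infsum)

lemma pmf_joint_sample:
  "pmf (joint_sample D M q) (s, r) = pmf D s * pmf (M s q) r"
proof -
  have *: "pmf (map_pmf (Pair t) (M t q)) (s, r) = indicator {s} t * pmf (M s q) r" for t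
  proof (cases "t = s")
    case True
    then show ?thesis by (simp add: pmf_map_inj' inj_on_def)
  next
    case False
    then show ?thesis by (auto simp: pmf_eq_0_set_pmf)
  qed
  show ?thesis
    by (simp add: joint_sample_def pmf_bind * measure_pmf_single)
qed

lemma pmf_prod_sample:
  "pmf (prod_sample D M q) (s, r) = pmf D s * pmf (response_dist D M q) r"
  by (simp add: prod_sample_def pmf_pair)

lemma pmf_joint_elem:
  "pmf (joint_elem D M q) (x, r) =
     (\<Sum>\<^sub>\<infinity>s. pmf D s * pmf (elem_given_sample s) x * pmf (M s q) r)"
  by (simp add: joint_elem_def pmf_bind_infsum pmf_pair mult.assoc)

lemma pmf_prod_elem:
  "pmf (prod_elem D M q) (x, r) = pmf (elem_dist D) x * pmf (response_dist D M q) r"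
  by (simp add: prod_elem_def pmf_pair)

end

theory Submission
  imports Defs
begin

text \<open>
  Let \<open>c = 1 - 2 p\<close> be the bias of a single entry, where \<open>p = Pr[f = 1]\<close>.  Biases multiply under
  exclusive or, so the parity of \<open>k\<close> independent entries is Bernoulli with bias \<open>c ^ k\<close>.
  Conditioning on the value of one entry leaves the parity of the other \<open>n - 1\<close> entries, possibly
  flipped; hence all conditional and unconditional probabilities of a response lie within
  \<open>c\<^sup>2 / 2\<close> of \<open>1/2\<close>, which gives LMI because \<open>\<bar>c\<bar> \<le> 2 \<epsilon> / 7\<close> is small.  On the other hand, the event
  that the response differs from the parity of the sample is impossible under the joint
  distribution, but has probability about \<open>1/2\<close> under the product distribution, so MI fails.
\<close>

section \<open>Indistinguishability via point masses\<close>

lemma measure_pmf_le_mult: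
  assumes "\<And>x. pmf D1 x \<le> K * pmf D2 x"
  shows "measure_pmf.prob D1 b \<le> K * measure_pmf.prob D2 b"
proof -
  have "measure_pmf.prob D1 b = infsetsum (pmf D1) b"
    by (rule measure_pmf_conv_infsetsum)
  also have "\<dots> \<le> infsetsum (\<lambda>x. K * pmf D2 x) b"
    using assms by (intro infsetsum_mono abs_summable_on_cmult_right pmf_abs_summable)
  also have "\<dots> = K * measure_pmf.prob D2 b"
    by (simp add: infsetsum_cmult_right pmf_abs_summable measure_pmf_conv_infsetsum)
  finally show ?thesis .
qed

text \<open>Multiplicative bounds on point masses sum to the same bounds on events; for \<delta> = 0
  this reduces everything to single outcomes.\<close>

lemma indistinguishable_pmfI:
  assumes "\<And>x. pmf D1 x \<le> exp \<epsilon> * pmf D2 x" and "\<And>x. pmf D2 x \<le> exp \<epsilon> * pmf D1 x"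
  shows "indistinguishable \<epsilon> 0 D1 D2"
  using assms by (auto simp: indistinguishable_def intro!: measure_pmf_le_mult)

text \<open>Events pull back along \<open>g\<close>. This lets responses stay Boolean until they are
  coded as numbers at the end.\<close>

lemma indistinguishable_map_pmf:
  "indistinguishable \<epsilon> \<delta> D1 D2 \<Longrightarrow> indistinguishable \<epsilon> \<delta> (map_pmf g D1) (map_pmf g D2)"
  by (auto simp: indistinguishable_def)

lemma pmf_bind_map_Pair:
  "pmf (bind_pmf D (\<lambda>x. map_pmf (Pair x) (g x))) (x, y) = pmf D x * pmf (g x) y"
proof -
  have *: "pmf (map_pmf (Pair t) (g t)) (x, y) = indicator {x} t * pmf (g x) y" for t
  proof (cases "t = x")
    case True
    then show ?thesis by (simp add: pmf_map_inj' inj_on_def)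
  next
    case False
    then show ?thesis by (auto simp: pmf_eq_0_set_pmf)
  qed
  show ?thesis
    by (simp add: pmf_bind * measure_pmf_single)
qed

section \<open>Law of the parity of independent entries\<close>

lemma bernoulli_pmf_xor:
  assumes "0 \<le> q" "q \<le> 1"
  shows "map_pmf (\<lambda>r. b \<noteq> r) (bernoulli_pmf q) = bernoulli_pmf (if b then 1 - q else q)"
proof (cases b)
  case True
  have "pmf (map_pmf Not (bernoulli_pmf q)) r = pmf (bernoulli_pmf (1 - q)) r" for r
    using pmf_map_inj'[of Not "bernoulli_pmf q" "\<not> r"] assms by (cases r) (auto simp: inj_def)
  moreover have "(\<lambda>r. b \<noteq> r) = Not"
    using True by auto
  ultimately show ?thesis
    using True by (auto intro: pmf_eqI)
next
  case False
  then show ?thesis by (simp add: map_pmf_ident)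
qed

lemma map_pmf_bernoulli:
  "map_pmf P D = bernoulli_pmf (measure_pmf.prob D {x. P x})"
proof (rule pmf_eqI)
  fix b
  have "P -` {True} = {x. P x}" "P -` {False} = UNIV - {x. P x}"
    by auto
  then show "pmf (map_pmf P D) b = pmf (bernoulli_pmf (measure_pmf.prob D {x. P x})) b"
    using measure_pmf.prob_compl[of "{x. P x}" D] by (cases b) (simp_all add: pmf_map)
qed

text \<open>Parity as a Boolean: prepending an entry becomes exclusive or, written
  \<open>\<noteq>\<close>.\<close>

definition odd_count :: "('x \<Rightarrow> bool) \<Rightarrow> 'x list \<Rightarrow> bool" where
  "odd_count P s \<longleftrightarrow> odd (length (filter P s))"

lemma odd_count_Nil [simp]: "\<not> odd_count P []"
  by (simp add: odd_count_def)

lemma odd_count_Cons [simp]: "odd_count P (x # s) \<longleftrightarrow> P x \<noteq> odd_count P s"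
  by (simp add: odd_count_def)

lemma parity_mechanism_odd_count:
  "parity_mechanism f s q = return_pmf (of_bool (odd_count (\<lambda>x. f x = 1) s))"
proof -
  have "card {i. i < length s \<and> f (s ! i) = 1} = length (filter (\<lambda>x. f x = 1) s)"
    by (simp add: length_filter_conv_card)
  then show ?thesis
    by (simp add: parity_mechanism_def odd_count_def mod_2_eq_odd)
qed

lemma map_odd_count_replicate_pmf_Suc:
  "map_pmf (odd_count P) (replicate_pmf (Suc k) D) =
     bind_pmf D (\<lambda>x. map_pmf (\<lambda>r. P x \<noteq> r) (map_pmf (odd_count P) (replicate_pmf k D)))"
  by (simp add: map_bind_pmf bind_map_pmf map_pmf_def[symmetric] pmf.map_comp o_def)

text \<open>The piling-up lemma: \<open>c\<close> is the mean of the sign that is -1 where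
  \<open>P\<close> holds and 1 elsewhere, and means of independent signs multiply.\<close>

lemma map_odd_count_replicate_pmf:
  fixes D :: "'x pmf" and P :: "'x \<Rightarrow> bool"
  defines "c \<equiv> 1 - 2 * measure_pmf.prob D {x. P x}"
  shows "map_pmf (odd_count P) (replicate_pmf k D) = bernoulli_pmf ((1 - c ^ k) / 2)"
proof (induction k)
  case 0
  show ?case by (rule pmf_eqI) (simp add: indicator_def split: bool.splits)
next
  case (Suc k)
  define p where "p = measure_pmf.prob D {x. P x}"
  have p: "0 \<le> p" "p \<le> 1"
    by (simp_all add: p_def)
  have "\<bar>c\<bar> \<le> 1"
    using p by (simp add: c_def p_def[symmetric])
  then have ck: "\<bar>c ^ j\<bar> \<le> 1" for j
    by (simp add: power_abs power_le_one)
  have q: "0 \<le> (1 - c ^ j) / 2" "(1 - c ^ j) / 2 \<le> 1" for j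
    using ck[of j] by auto
  define q where "q = (1 - c ^ k) / 2"
  have "map_pmf (odd_count P) (replicate_pmf (Suc k) D) =
          bind_pmf (map_pmf P D) (\<lambda>b. map_pmf (\<lambda>r. b \<noteq> r) (bernoulli_pmf q))"
    unfolding map_odd_count_replicate_pmf_Suc Suc.IH q_def[symmetric] by (simp add: bind_map_pmf)
  also have "\<dots> = bind_pmf (bernoulli_pmf p) (\<lambda>b. bernoulli_pmf (if b then 1 - q else q))"
    using q[of k] unfolding q_def[symmetric] map_pmf_bernoulli[of P D] p_def[symmetric]
    by (simp only: bernoulli_pmf_xor)
  also have "\<dots> = bernoulli_pmf ((1 - c ^ Suc k) / 2)"
  proof (rule pmf_eqI)
    fix b
    \<comment> \<open>Variables \<open>d\<close> and \<open>w\<close> stand for \<open>c\<close> and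
      \<open>c ^ k\<close>, so that the arithmetic treats them as atoms.\<close>
    have "p * (1 - (1 - w) / 2) + (1 - p) * ((1 - w) / 2) = (1 - d * w) / 2"
      if "d = 1 - 2 * p" for d w :: real
      by (simp add: that field_simps)
    from this[of c "c ^ k"] have "p * (1 - q) + (1 - p) * q = (1 - c ^ Suc k) / 2"
      by (simp add: q_def c_def p_def)
    then show "pmf (bind_pmf (bernoulli_pmf p) (\<lambda>b. bernoulli_pmf (if b then 1 - q else q))) b =
        pmf (bernoulli_pmf ((1 - c ^ Suc k) / 2)) b"
      using p q[of k] q[of "Suc k"]
      by (cases b) (simp_all add: pmf_bind q_def[symmetric] field_simps del: power_Suc)
  qed
  finally show ?case .
qed

section \<open>Joint law of one entry and the parity\<close>

lemma map_nth_odd_count_replicate_pmf: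
  assumes "i \<le> k"
  shows "map_pmf (\<lambda>s. (s ! i, odd_count P s)) (replicate_pmf (Suc k) D) =
    bind_pmf D (\<lambda>x. map_pmf (Pair x) (map_pmf (\<lambda>r. P x \<noteq> r)
      (map_pmf (odd_count P) (replicate_pmf k D))))"
  using assms
proof (induction k arbitrary: i)
  case 0
  then show ?case
    by (simp add: map_bind_pmf bind_return_pmf)
next
  case (Suc k)
  show ?case
  proof (cases i)
    case 0
    then show ?thesis
      by (subst replicate_pmf.simps)
         (simp add: map_bind_pmf pmf.map_comp o_def map_pmf_def[symmetric] del: replicate_pmf.simps)
  next
    case (Suc j)
    let ?S = "replicate_pmf k D"
    have "map_pmf (\<lambda>s. (s ! i, odd_count P s)) (replicate_pmf (Suc (Suc k)) D) =
        bind_pmf D (\<lambda>y. map_pmf (\<lambda>(x, r). (x, P y \<noteq> r))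
          (map_pmf (\<lambda>s. (s ! j, odd_count P s)) (replicate_pmf (Suc k) D)))"
      by (subst replicate_pmf.simps)
         (simp add: Suc map_bind_pmf pmf.map_comp o_def map_pmf_def[symmetric] del: replicate_pmf.simps)
    \<comment> \<open>\<open>y\<close> is the head; the induction hypothesis draws the selected
      entry \<open>x\<close> of the tail ahead of the other \<open>k\<close> entries.\<close>
    also have "\<dots> = bind_pmf D (\<lambda>y. bind_pmf D (\<lambda>x.
        map_pmf (\<lambda>s. (x, P y \<noteq> (P x \<noteq> odd_count P s))) ?S))"
      using Suc Suc.prems Suc.IH[of j]
      by (simp add: map_bind_pmf pmf.map_comp o_def del: replicate_pmf.simps)
    \<comment> \<open>The independent draws of \<open>x\<close> and \<open>y\<close> commute, as do
      their contributions to the parity; \<open>y\<close> then joins the unselected entries.\<close>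
    also have "\<dots> = bind_pmf D (\<lambda>x. bind_pmf D (\<lambda>y.
        map_pmf (\<lambda>s. (x, P x \<noteq> (P y \<noteq> odd_count P s))) ?S))"
      by (subst bind_commute_pmf) (intro bind_pmf_cong map_pmf_cong; auto)
    also have "\<dots> = bind_pmf D (\<lambda>x. map_pmf (Pair x) (map_pmf (\<lambda>r. P x \<noteq> r)
        (map_pmf (odd_count P) (replicate_pmf (Suc k) D))))"
      unfolding map_odd_count_replicate_pmf_Suc
      by (simp add: map_bind_pmf pmf.map_comp o_def del: replicate_pmf.simps)
    finally show ?thesis .
  qed
qed

text \<open>All samples have length \<open>n\<close>, so the random index is independent of the
  sample and can be drawn first. Every index yields the same law, so averaging over it changes
  nothing.\<close>

lemma joint_elem_parity:
  assumes "0 < n"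
  shows "joint_elem (replicate_pmf n D) (parity_mechanism f) q =
    map_pmf (apsnd of_bool) (bind_pmf D (\<lambda>x. map_pmf (Pair x) (map_pmf (\<lambda>r. (f x = 1) \<noteq> r)
      (map_pmf (odd_count (\<lambda>x. f x = 1)) (replicate_pmf (n - 1) D)))))"
    (is "_ = map_pmf _ ?J")
proof -
  let ?P = "\<lambda>x. f x = 1"
  let ?S = "replicate_pmf n D"
  let ?U = "pmf_of_set {..<n}"
  obtain k where n: "n = Suc k"
    using assms by (cases n) auto
  have len: "length s = n" if "s \<in> set_pmf ?S" for s
    using that by (simp add: set_replicate_pmf)
  have "joint_elem ?S (parity_mechanism f) q =
      bind_pmf ?S (\<lambda>s. map_pmf (\<lambda>i. (s ! i, of_bool (odd_count ?P s))) ?U)"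
    unfolding joint_elem_def
    by (intro bind_pmf_cong refl)
       (simp add: len elem_given_sample_def parity_mechanism_odd_count pair_return_pmf2
          pmf.map_comp o_def)
  also have "\<dots> = bind_pmf ?U (\<lambda>i. map_pmf (\<lambda>s. (s ! i, of_bool (odd_count ?P s))) ?S)"
    unfolding map_pmf_def by (rule bind_commute_pmf)
  also have "\<dots> = bind_pmf ?U (\<lambda>i. map_pmf (apsnd of_bool) ?J)"
  proof (rule bind_pmf_cong[OF refl])
    fix i assume "i \<in> set_pmf ?U"
    then have "i \<le> k"
      using n by (simp add: set_pmf_of_set lessThan_empty_iff)
    from map_nth_odd_count_replicate_pmf[OF this, of ?P D]
    have "map_pmf (\<lambda>s. (s ! i, odd_count ?P s)) ?S = ?J"
      by (simp add: n)
    then show "map_pmf (\<lambda>s. (s ! i, of_bool (odd_count ?P s))) ?S = map_pmf (apsnd of_bool) ?J"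
      by (metis (no_types, lifting) apsnd_conv map_pmf_comp map_pmf_cong)
  qed
  finally show ?thesis by simp
qed

lemma elem_dist_replicate_pmf:
  assumes "0 < n"
  shows "elem_dist (replicate_pmf n D) = D"
proof -
  \<comment> \<open>The first marginal of \<open>joint_elem\<close> is the same for every mechanism;
    the parity of the zero function is a convenient choice.\<close>
  have "elem_dist (replicate_pmf n D) = 
     map_pmf fst (joint_elem (replicate_pmf n D) (parity_mechanism (\<lambda>_. 0)) ())"
    by (simp add: elem_dist_def joint_elem_def map_bind_pmf map_fst_pair_pmf)
  also have "\<dots> = D"
    by (simp add: joint_elem_parity[OF assms] map_bind_pmf pmf.map_comp o_def bind_return_pmf')
  finally show ?thesis .
qed

lemma response_dist_parity:
  "response_dist D (parity_mechanism f) q =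
     map_pmf of_bool (map_pmf (odd_count (\<lambda>x. f x = 1)) D)"
  by (simp add: response_dist_def parity_mechanism_odd_count map_pmf_def bind_assoc_pmf
      bind_return_pmf)

section \<open>Local max-information of the parity\<close>

lemma LMI_parity:
  fixes f :: "'x \<Rightarrow> nat"
  assumes "3 \<le> n" "0 \<le> \<alpha>" "\<alpha> \<le> min \<epsilon> (7/10) / 7"
    and prob: "measure_pmf.prob D {x. f x = 1} = 1/2 + \<alpha>"
  shows "LMI \<epsilon> 0 (replicate_pmf n D) (parity_mechanism f) q"
proof -
  \<comment> \<open>This is the bias 1 - 2 p for p = 1/2 + \<alpha>; \<open>Q k\<close> is the
    probability of odd parity among \<open>k\<close> entries.\<close>
  define c where "c = - 2 * \<alpha>"
  define Q where "Q k = (1 - c ^ k) / 2" for k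
  have c: "\<bar>c\<bar> \<le> 1/5" "\<bar>c\<bar> \<le> 2/7 * \<epsilon>"
    using assms by (auto simp: c_def)
  have "c\<^sup>2 \<le> \<bar>c\<bar> * (1/5)"
    using c mult_left_mono[of "\<bar>c\<bar>" "1/5" "\<bar>c\<bar>"] by (simp add: power2_eq_square)
  then have c2: "c\<^sup>2 \<le> 1/25" "c\<^sup>2 \<le> 2/35 * \<epsilon>"
    using c by auto
  have "\<epsilon> \<ge> 0"
    using c by auto
  \<comment> \<open>After clearing denominators,
    \<open>2 * c\<^sup>2 + \<epsilon> * c\<^sup>2 \<le> \<epsilon>\<close> is what is needed, and
    4/35 + 1/25 < 1. Then 1 + \<epsilon> \<le> exp \<epsilon>.\<close>
  have ratio: "a \<le> exp \<epsilon> * b"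
    if "a \<le> (1 + c\<^sup>2) / 2" "(1 - c\<^sup>2) / 2 \<le> b" for a b :: real
  proof -
    have "\<epsilon> * c\<^sup>2 \<le> \<epsilon> * (1/25)"
      using \<open>\<epsilon> \<ge> 0\<close> c2 by (intro mult_left_mono) auto
    then have "(1 + c\<^sup>2) / 2 \<le> (1 + \<epsilon>) * ((1 - c\<^sup>2) / 2)"
      using c2 \<open>\<epsilon> \<ge> 0\<close> by (simp add: field_simps)
    also have "\<dots> \<le> exp \<epsilon> * b"
      using that c2 exp_ge_add_one_self[of \<epsilon>] by (intro mult_mono) auto
    finally show ?thesis using that by simp
  qed
  \<comment> \<open>Applied to \<open>n\<close> and \<open>n - 1\<close>, both at least 2 because n
    \<ge> 3.\<close>
  have power: "\<bar>c ^ k\<bar> \<le> c\<^sup>2" if "k \<ge> 2" for k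
    using power_decreasing[OF that, of "\<bar>c\<bar>"] c by (simp add: power_abs)
  have near: "\<bar>Q k - 1/2\<bar> \<le> c\<^sup>2 / 2" if "k \<ge> 2" for k
  proof -
    have "Q k - 1/2 = - (c ^ k / 2)"
      by (simp add: Q_def field_simps)
    then show ?thesis using power[OF that] by simp
  qed
  have Q01: "0 \<le> Q k" "Q k \<le> 1" if "k \<ge> 2" for k
    using near[OF that] c2 by linarith+
  have parity: "map_pmf (odd_count (\<lambda>x. f x = 1)) (replicate_pmf k D) = bernoulli_pmf (Q k)" for k
    unfolding map_odd_count_replicate_pmf prob by (simp add: Q_def c_def)
  \<comment> \<open>\<open>g x\<close> is the law of the response given the entry \<open>x\<close>;
    \<open>J\<close> and \<open>R\<close> are the joint and product laws with Boolean
    responses.\<close>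
  define g where "g x = bernoulli_pmf (if f x = 1 then 1 - Q (n - 1) else Q (n - 1))" for x
  define J where "J = bind_pmf D (\<lambda>x. map_pmf (Pair x) (g x))"
  define R where "R = pair_pmf D (bernoulli_pmf (Q n))"
  have joint: "joint_elem (replicate_pmf n D) (parity_mechanism f) q = map_pmf (apsnd of_bool) J"
  proof -
    have "0 < n" "2 \<le> n - 1"
      using assms(1) by auto
    then show ?thesis
      unfolding J_def g_def
      by (simp only: joint_elem_parity parity bernoulli_pmf_xor[OF Q01])
  qed
  have prod: "prod_elem (replicate_pmf n D) (parity_mechanism f) q = map_pmf (apsnd of_bool) R"
    using assms(1) map_pair[of id "of_bool :: bool \<Rightarrow> nat" D "bernoulli_pmf (Q n)"]
    unfolding prod_elem_def response_dist_parity parity R_def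
    by (simp add: elem_dist_replicate_pmf apsnd_def map_prod_def id_def map_pmf_ident)
  have bernoulli: "(1 - c\<^sup>2) / 2 \<le> pmf (bernoulli_pmf u) b \<and> pmf (bernoulli_pmf u) b \<le> (1 + c\<^sup>2) / 2"
    if "\<bar>u - 1/2\<bar> \<le> c\<^sup>2 / 2" for u b
  proof -
    have u: "1/2 - c\<^sup>2 / 2 \<le> u" "u \<le> 1/2 + c\<^sup>2 / 2"
      using that by linarith+
    then have "0 \<le> u" "u \<le> 1"
      using c2(1) by linarith+
    then show ?thesis
      using u by (cases b) (simp_all add: field_simps)
  qed
  have near': "\<bar>(if b then 1 - Q (n - 1) else Q (n - 1)) - 1/2\<bar> \<le> c\<^sup>2 / 2" for b
  proof -
    have "\<bar>Q (n - 1) - 1/2\<bar> \<le> c\<^sup>2 / 2"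
      using assms(1) by (intro near) simp
    then show ?thesis
      by (auto simp: abs_minus_commute)
  qed
  have g: "(1 - c\<^sup>2) / 2 \<le> pmf (g x) b" "pmf (g x) b \<le> (1 + c\<^sup>2) / 2" for x b
    using bernoulli[OF near'] by (simp_all add: g_def)
  have r: "(1 - c\<^sup>2) / 2 \<le> pmf (bernoulli_pmf (Q n)) b"
    "pmf (bernoulli_pmf (Q n)) b \<le> (1 + c\<^sup>2) / 2" for b
    using bernoulli[OF near[of n]] assms(1) by simp_all
  \<comment> \<open>Both masses share the factor \<open>pmf D x\<close>, which leaves two response
    probabilities for \<open>ratio\<close> to compare.\<close>
  have "indistinguishable \<epsilon> 0 J R"
  proof (rule indistinguishable_pmfI)
    fix z :: "'x \<times> bool"
    obtain x b where z: "z = (x, b)"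
      by (cases z)
    have J: "pmf J z = pmf D x * pmf (g x) b"
      by (simp add: z J_def pmf_bind_map_Pair)
    have R: "pmf R z = pmf D x * pmf (bernoulli_pmf (Q n)) b"
      by (simp add: z R_def pmf_pair)
    show "pmf J z \<le> exp \<epsilon> * pmf R z"
      unfolding J R mult.left_commute[of "exp \<epsilon>"] by (intro mult_left_mono ratio g r) auto
    show "pmf R z \<le> exp \<epsilon> * pmf J z"
      unfolding J R mult.left_commute[of "exp \<epsilon>"] by (intro mult_left_mono ratio g r) auto
  qed
  then show ?thesis
    unfolding LMI_def joint prod by (rule indistinguishable_map_pmf)
qed

section \<open>Failure of max-information\<close>

lemma not_MI_parity:
  fixes f :: "'x \<Rightarrow> nat"
  assumes "3 \<le> n" "0 \<le> \<alpha>" "\<alpha> \<le> 1/10"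
    and prob: "measure_pmf.prob D {x. f x = 1} = 1/2 + \<alpha>"
  shows "\<not> MI 1 (1/5) (replicate_pmf n D) (parity_mechanism f) q"
proof -
  define par where "par = odd_count (\<lambda>x. f x = 1)"
  define S where "S = replicate_pmf n D"
  define c where "c = - 2 * \<alpha>"
  define u where "u = (1 - c ^ n) / 2"
  have "\<bar>c\<bar> \<le> 1/5"
    using assms by (simp add: c_def)
  then have "\<bar>c\<bar> ^ n \<le> \<bar>c\<bar> ^ 1"
    using assms(1) by (intro power_decreasing) auto
  then have cn: "\<bar>c ^ n\<bar> \<le> 1/5"
    using \<open>\<bar>c\<bar> \<le> 1/5\<close> by (simp add: power_abs)
  then have u: "2/5 \<le> u" "u \<le> 3/5"
    by (auto simp: u_def)
  have parity: "map_pmf par S = bernoulli_pmf u"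
    unfolding par_def S_def map_odd_count_replicate_pmf prob by (simp add: u_def c_def)
  let ?B = "{(s, r). r \<noteq> (of_bool (par s) :: nat)}"
  have "joint_sample S (parity_mechanism f) q = map_pmf (\<lambda>s. (s, of_bool (par s))) S"
    by (simp add: joint_sample_def parity_mechanism_odd_count par_def map_pmf_def bind_return_pmf)
  then have joint: "measure_pmf.prob (joint_sample S (parity_mechanism f) q) ?B = 0"
    by (simp add: vimage_def)
  \<comment> \<open>Under the product law the response is the parity of an independent second
    sample, so \<open>?B\<close> says that two independent Bernoulli bits differ.\<close>
  let ?C = "{(a, b). b \<noteq> a} :: (bool \<times> bool) set"
  have "prod_sample S (parity_mechanism f) q =
      map_pmf (\<lambda>(s, t). (s, of_bool (par t))) (pair_pmf S S)"
    using map_pair[of id "\<lambda>t. of_bool (par t) :: nat" S S, symmetric]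
    by (simp add: prod_sample_def response_dist_parity par_def pmf.map_comp o_def map_pmf_ident id_def)
  then have "measure_pmf.prob (prod_sample S (parity_mechanism f) q) ?B =
      measure_pmf.prob (map_pmf (\<lambda>(s, t). (par s, par t)) (pair_pmf S S)) ?C"
    by (auto simp: vimage_def split_def intro!: arg_cong[where f = "measure_pmf.prob _"])
  also have "\<dots> = measure_pmf.prob (pair_pmf (bernoulli_pmf u) (bernoulli_pmf u)) ?C"
    by (simp only: map_pair parity)
  also have "?C = {(True, False), (False, True)}"
    by auto
  also have "measure_pmf.prob (pair_pmf (bernoulli_pmf u) (bernoulli_pmf u)) \<dots> = 2 * (u * (1 - u))"
    using u by (simp add: measure_measure_pmf_finite pmf_pair)
  finally have prod: "measure_pmf.prob (prod_sample S (parity_mechanism f) q) ?B = 2 * (u * (1 - u))" .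
  \<comment> \<open>Hence \<open>?B\<close> has product probability at least 8/25 > 1/5, while its
    joint probability 0 annihilates the factor \<open>exp 1\<close>.\<close>
  have "(2/5) * (2/5) \<le> u * (1 - u)"
    using u by (intro mult_mono) auto
  then have "\<not> measure_pmf.prob (prod_sample S (parity_mechanism f) q) ?B
      \<le> exp 1 * measure_pmf.prob (joint_sample S (parity_mechanism f) q) ?B + 1/5"
    unfolding joint prod by simp
  then show ?thesis
    unfolding MI_def indistinguishable_def S_def[symmetric] by blast
qed

theorem theorem4p14:
  fixes \<epsilon> :: real and n :: nat and f :: "'x::countable \<Rightarrow> nat"
  assumes "\<epsilon> > 0" and "n \<ge> 3" and "range f = {0, 1}"
  shows "(\<exists>DX :: 'x pmf. \<forall>q :: 'q.
            LMI \<epsilon> 0 (replicate_pmf n DX) (parity_mechanism f) q \<and>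
            \<not> MI 1 (1/5) (replicate_pmf n DX) (parity_mechanism f) q)
       \<and> (\<forall>(DX :: 'x pmf) \<alpha>.
            0 \<le> \<alpha> \<and> \<alpha> \<le> min \<epsilon> (7/10) / 7 \<and> measure_pmf.prob DX {x. f x = 1} = 1/2 + \<alpha> \<longrightarrow>
            (\<forall>q :: 'q.
               LMI \<epsilon> 0 (replicate_pmf n DX) (parity_mechanism f) q \<and>
               \<not> MI 1 (1/5) (replicate_pmf n DX) (parity_mechanism f) q))"
proof -
  \<comment> \<open>The cap 7/10, divided by 7, supplies the bound \<alpha> \<le> 1/10 of
    \<open>not_MI_parity\<close>.\<close>
  have biased: "LMI \<epsilon> 0 (replicate_pmf n DX) (parity_mechanism f) q \<and>
      \<not> MI 1 (1/5) (replicate_pmf n DX) (parity_mechanism f) q"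
    if "0 \<le> \<alpha>" "\<alpha> \<le> min \<epsilon> (7/10) / 7" "measure_pmf.prob DX {x. f x = 1} = 1/2 + \<alpha>"
    for DX :: "'x pmf" and \<alpha> and q :: 'q
    using LMI_parity[OF assms(2) that, of q] not_MI_parity[OF assms(2) that(1) _ that(3), of q] that(2)
    by simp
  obtain x0 x1 where x: "f x0 = 0" "f x1 = 1"
    using assms(3) by (metis (mono_tags) imageE insertI1 insertI2)
  \<comment> \<open>A fair coin between one point of each fibre of \<open>f\<close> realizes the
    case \<alpha> = 0.\<close>
  define DX where "DX = map_pmf (\<lambda>b. if b then x1 else x0) (bernoulli_pmf (1/2))"
  have "(\<lambda>b. if b then x1 else x0) -` {x. f x = 1} = {True}"
    using x by auto
  then have "measure_pmf.prob DX {x. f x = 1} = 1/2 + 0"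
    by (simp add: DX_def measure_pmf_single)
  with assms(1) biased[of 0 DX] biased show ?thesis
    by (intro conjI exI[of _ DX]) auto
qed

end
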